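(* Put $r=2/5$ and $$\Sigma_+=\begin{pmatrix} 1 & r & 0 & r \\ r & 1 & r & 0 \\ 0 & r & 1 & r \\ r & 0 & r & 1 \end{pmatrix},\qquad\Sigma_-=\begin{pmatrix} 1 & r & 0 & -r \\ r & 1 & r & 0 \\ 0 & r & 1 & r \\ -r & 0 & r & 1 \end{pmatrix}.$$ Both matrices are positive definite. They are not diagonally sign-conjugate, but every pair of corresponding principal submatrices of order at most three is diagonally sign-conjugate. Consequently, if $X^+$ and $X^-$ are centered Gaussian vectors in $\mathbb{R}^4$ with correlation matrices $\Sigma_+$ and $\Sigma_-$, respectively (and unit variances), then all labelled absolute product moments involving at most three distinct coordinates agree for $X^+$ and $X^-$, although $\Sigma_+$ and $\Sigma_-$ belong to different sign-gauge classes.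
   Context: Two symmetric $k\times k$ matrices $A,B$ are diagonally sign-conjugate (in the same sign-gauge class) if $B=D_\varepsilon AD_\varepsilon$ for some $D_\varepsilon=\operatorname{diag}(\varepsilon_1,\ldots,\varepsilon_k)$ with $\varepsilon_i\in\{\pm1\}$. Corresponding principal submatrices are those indexed by the same subset of $\{1,2,3,4\}$. A labelled absolute product moment involving at most three distinct coordinates is the expectation of a product of powers $|X_i|^{p_i}$ over a set of at most three indices $i$. *)

theory Defs
  imports "HOL-Probability.Probability" "Jordan_Normal_Form.DL_Submatrix"
begin

(* Matrices have row and column indices starting at 0, so the coordinate labels 1,2,3,4
   appear as 0,1,2,3. *)

definition Sigma_plus :: "real mat" where
  "Sigma_plus = (let r = 2/5 in mat_of_rows_list 4
     [[1, r, 0, r],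
      [r, 1, r, 0],
      [0, r, 1, r],
      [r, 0, r, 1]])"

definition Sigma_minus :: "real mat" where
  "Sigma_minus = (let r = 2/5 in mat_of_rows_list 4
     [[ 1, r, 0, -r],
      [ r, 1, r,  0],
      [ 0, r, 1,  r],
      [-r, 0, r,  1]])"

definition positive_definite :: "nat \<Rightarrow> real mat \<Rightarrow> bool" where
  "positive_definite k A \<longleftrightarrow> A \<in> carrier_mat k k \<and> transpose_mat A = A \<and>
     (\<forall>v \<in> carrier_vec k. v \<noteq> 0\<^sub>v k \<longrightarrow> scalar_prod v (A *\<^sub>v v) > 0)"

definition diag_sign_conjugate :: "nat \<Rightarrow> real mat \<Rightarrow> real mat \<Rightarrow> bool" where
  "diag_sign_conjugate k A B \<longleftrightarrow>
     A \<in> carrier_mat k k \<and> B \<in> carrier_mat k k \<and> transpose_mat A = A \<and> transpose_mat B = B \<and>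
     (\<exists>\<epsilon> :: nat \<Rightarrow> real. (\<forall>i<k. \<epsilon> i \<in> {1, -1}) \<and> B = mat_diag k \<epsilon> * A * mat_diag k \<epsilon>)"

abbreviation principal_submatrix :: "real mat \<Rightarrow> nat set \<Rightarrow> real mat" where
  "principal_submatrix A S \<equiv> submatrix A S S"

(* A constant counts as a degenerate normal variable. *)
definition normal_rv :: "'a measure \<Rightarrow> ('a \<Rightarrow> real) \<Rightarrow> bool" where
  "normal_rv M Y \<longleftrightarrow>
     (\<exists>\<mu> \<sigma>. 0 < \<sigma> \<and> distributed M lborel Y (normal_density \<mu> \<sigma>)) \<or>
     (\<exists>c. AE \<omega> in M. Y \<omega> = c)"

(* A random vector in R^k is given by its coordinate variables X 0, ..., X (k - 1);
   it is Gaussian iff every linear combination of the coordinates is normal. *)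
definition gaussian_vector :: "'a measure \<Rightarrow> nat \<Rightarrow> (nat \<Rightarrow> 'a \<Rightarrow> real) \<Rightarrow> bool" where
  "gaussian_vector M k X \<longleftrightarrow> prob_space M \<and>
     (\<forall>i<k. X i \<in> borel_measurable M) \<and>
     (\<forall>u :: nat \<Rightarrow> real. normal_rv M (\<lambda>\<omega>. \<Sum>i<k. u i * X i \<omega>))"

definition centered :: "'a measure \<Rightarrow> nat \<Rightarrow> (nat \<Rightarrow> 'a \<Rightarrow> real) \<Rightarrow> bool" where
  "centered M k X \<longleftrightarrow> (\<forall>i<k. prob_space.expectation M (X i) = 0)"

definition covariance :: "'a measure \<Rightarrow> ('a \<Rightarrow> real) \<Rightarrow> ('a \<Rightarrow> real) \<Rightarrow> real" where
  "covariance M Y Z = prob_space.expectation M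
     (\<lambda>\<omega>. (Y \<omega> - prob_space.expectation M Y) * (Z \<omega> - prob_space.expectation M Z))"

definition unit_variances :: "'a measure \<Rightarrow> nat \<Rightarrow> (nat \<Rightarrow> 'a \<Rightarrow> real) \<Rightarrow> bool" where
  "unit_variances M k X \<longleftrightarrow> (\<forall>i<k. prob_space.variance M (X i) = 1)"

definition correlation_matrix :: "'a measure \<Rightarrow> nat \<Rightarrow> (nat \<Rightarrow> 'a \<Rightarrow> real) \<Rightarrow> real mat" where
  "correlation_matrix M k X = Matrix.mat k k (\<lambda>(i, j). covariance M (X i) (X j) /
     (sqrt (prob_space.variance M (X i)) * sqrt (prob_space.variance M (X j))))"

(* The expectation of a nonnegative variable, as an extended real: it always exists.
   powr maps base 0 to 0 for every exponent, including exponents \<le> 0; this does not affect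
   the value when no coordinate X i vanishes with positive probability, in particular for
   Gaussian coordinates of unit variance. *)
definition abs_product_moment ::
    "'a measure \<Rightarrow> (nat \<Rightarrow> 'a \<Rightarrow> real) \<Rightarrow> nat set \<Rightarrow> (nat \<Rightarrow> real) \<Rightarrow> ennreal" where
  "abs_product_moment M X S p = (\<integral>\<^sup>+\<omega>. ennreal (\<Prod>i\<in>S. \<bar>X i \<omega>\<bar> powr p i) \<partial>M)"

end

(* Every linear combination of a centered Gaussian vector is normal with a law fixed by its variance,
   so by the Cramer-Wold device the law of a subvector is determined by its covariances.
   Sigma_plus and Sigma_minus differ only in the sign of one edge of a 4-cycle of correlations.
   The product of the signs around the cycle is gauge invariant, which separates the two matrices;
   deleting a coordinate breaks the cycle, and then flipping the sign of a single coordinate, which is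
   invisible to absolute moments, matches the remaining covariances. *)
theory Submission
  imports Defs
begin

text \<open>The uniqueness theorem at the base is one-dimensional: it compares probability measures
  on the real line by their characteristic functions. To reach several dimensions, one coordinate is
  treated at a time, and the others then act as a weight, a product of indicators times a complex
  exponential. Such a weight is not a probability density, hence the passage from nonnegative
  weights to bounded complex ones. Joint densities never appear, so degenerate linear combinations
  are covered.

  Moments are compared as extended reals, for arbitrary real exponents; with negative exponents they
  may be infinite. Finiteness for nonnegative exponents is a separate matter and reduces to moments
  of single coordinates.

  The choice r = 2/5 lies below 1/2: the least eigenvalue of \<open>Sigma_plus\<close> is 1 - 2r, as
  the adjacency matrix of the 4-cycle has least eigenvalue -2.\<close>

section \<open>Uniqueness for weighted laws on the real line\<close>

text \<open>Dividing a nonnegative weight by its total mass makes it a probability density. Under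
  the tilted measure the law of \<open>X\<close> has the weighted transform over \<open>c\<close> as
  its characteristic function, which brings weighted integrals within reach of uniqueness for
  probability laws.\<close>

lemma tilted_law:
  fixes h :: "'a \<Rightarrow> real"
  assumes [measurable]: "X \<in> borel_measurable M"
    and h: "integrable M h" "\<And>\<omega>. 0 \<le> h \<omega>"
    and c: "(\<integral>\<omega>. h \<omega> \<partial>M) = c" "0 < c"
  defines "L \<equiv> distr (density M (\<lambda>\<omega>. ennreal (h \<omega> / c))) borel X"
  shows "real_distribution L"
    and "char L t = (CLINT \<omega>|M. complex_of_real (h \<omega>) * iexp (t * X \<omega>)) / complex_of_real c"
    and "A \<in> sets borel \<Longrightarrow> (\<integral>\<omega>. h \<omega> * indicator A (X \<omega>) \<partial>M) = c * measure L A"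
proof -
  have [measurable]: "h \<in> borel_measurable M"
    using h by auto
  have "emeasure (density M (\<lambda>\<omega>. ennreal (h \<omega> / c))) (space M) = 1"
    using h c by (simp add: emeasure_density nn_integral_eq_integral cong: nn_integral_cong_simp)
  then interpret D: prob_space "density M (\<lambda>\<omega>. ennreal (h \<omega> / c))"
    by (intro prob_spaceI) simp
  have X: "X \<in> borel_measurable (density M (\<lambda>\<omega>. ennreal (h \<omega> / c)))" by simp
  show L: "real_distribution L"
    unfolding L_def using D.real_distribution_distr[OF X] .
  interpret L: real_distribution L by fact
  have "char L t = (CLINT \<omega>|M. (h \<omega> / c) *\<^sub>R iexp (t * X \<omega>))"
    unfolding L_def char_def using h c
    by (simp add: integral_distr integral_density)
  also have "\<dots> = (CLINT \<omega>|M. (complex_of_real (h \<omega>) * iexp (t * X \<omega>)) / complex_of_real c)"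
    by (simp add: scaleR_conv_of_real)
  finally show "char L t = (CLINT \<omega>|M. complex_of_real (h \<omega>) * iexp (t * X \<omega>)) / complex_of_real c"
    by simp
  assume A[measurable]: "A \<in> sets borel"
  have "measure L A = (\<integral>x. indicator A x \<partial>L)"
    by (simp add: L_def)
  also have "\<dots> = (\<integral>\<omega>. (h \<omega> / c) * indicator A (X \<omega>) \<partial>M)"
    unfolding L_def using h c by (subst integral_distr) (simp_all add: integral_density)
  also have "\<dots> = (\<integral>\<omega>. h \<omega> * indicator A (X \<omega>) \<partial>M) / c"
    by simp
  finally show "(\<integral>\<omega>. h \<omega> * indicator A (X \<omega>) \<partial>M) = c * measure L A"
    using c by simp
qed

text \<open>At \<open>t = 0\<close> the transforms are the total masses, so both weights are
  normalised by the same \<open>c\<close> and Levy's theorem applies. Mass 0 cannot be normalised,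
  but then both weights vanish almost everywhere.\<close>

lemma weighted_law_eqI_nonneg:
  fixes h :: "'a \<Rightarrow> real" and g :: "'b \<Rightarrow> real"
  assumes X: "X \<in> borel_measurable M" and Y: "Y \<in> borel_measurable N"
    and h: "integrable M h" "\<And>\<omega>. 0 \<le> h \<omega>" and g: "integrable N g" "\<And>\<omega>. 0 \<le> g \<omega>"
    and eq: "\<And>t. (CLINT \<omega>|M. complex_of_real (h \<omega>) * iexp (t * X \<omega>)) =
                   (CLINT \<omega>|N. complex_of_real (g \<omega>) * iexp (t * Y \<omega>))"
    and A: "A \<in> sets borel"
  shows "(\<integral>\<omega>. h \<omega> * indicator A (X \<omega>) \<partial>M) = (\<integral>\<omega>. g \<omega> * indicator A (Y \<omega>) \<partial>N)"
proof -
  define c where "c = (\<integral>\<omega>. h \<omega> \<partial>M)"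
  have "complex_of_real (\<integral>\<omega>. h \<omega> \<partial>M) = complex_of_real (\<integral>\<omega>. g \<omega> \<partial>N)"
    using eq[of 0] by simp
  then have cg: "(\<integral>\<omega>. g \<omega> \<partial>N) = c"
    unfolding c_def of_real_eq_iff by simp
  have [measurable]: "h \<in> borel_measurable M" "g \<in> borel_measurable N"
    using h g by auto
  show ?thesis
  proof (cases "c = 0")
    case True
    have "AE \<omega> in M. h \<omega> = 0"
      using True h by (simp add: c_def integral_nonneg_eq_0_iff_AE)
    moreover have "AE \<omega> in N. g \<omega> = 0"
      using True cg g integral_nonneg_eq_0_iff_AE[OF g(1)] by simp
    ultimately have "AE \<omega> in M. h \<omega> * indicator A (X \<omega>) = 0" "AE \<omega> in N. g \<omega> * indicator A (Y \<omega>) = 0"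
      by auto
    then show ?thesis
      by (simp add: integral_eq_zero_AE)
  next
    case False
    then have c: "0 < c"
      using h by (simp add: c_def less_le Bochner_Integration.integral_nonneg)
    note LM = tilted_law[OF X h c_def[symmetric] c] and LN = tilted_law[OF Y g cg c]
    have "char (distr (density M (\<lambda>\<omega>. ennreal (h \<omega> / c))) borel X) =
          char (distr (density N (\<lambda>\<omega>. ennreal (g \<omega> / c))) borel Y)"
      by (intro ext) (simp only: LM(2) LN(2) eq)
    from Levy_uniqueness[OF LM(1) LN(1) this] show ?thesis
      by (simp only: LM(3)[OF A] LN(3)[OF A])
  qed
qed

text \<open>For a bounded complex weight, both \<open>1 + Re h\<close> and \<open>1 + Im h\<close> are nonnegative weights
  whose transforms are determined by those of \<open>1\<close> and \<open>h\<close>.\<close>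
lemma weighted_law_eqI_Re:
  fixes h :: "'a \<Rightarrow> complex" and g :: "'b \<Rightarrow> complex"
  assumes "prob_space M" "prob_space N"
    and [measurable]: "X \<in> borel_measurable M" "Y \<in> borel_measurable N"
    and [measurable]: "h \<in> borel_measurable M" "g \<in> borel_measurable N"
    and h: "\<And>\<omega>. norm (h \<omega>) \<le> 1" and g: "\<And>\<omega>. norm (g \<omega>) \<le> 1"
    and eq1: "\<And>t. (CLINT \<omega>|M. iexp (t * X \<omega>)) = (CLINT \<omega>|N. iexp (t * Y \<omega>))"
    and eq: "\<And>t. (CLINT \<omega>|M. h \<omega> * iexp (t * X \<omega>)) = (CLINT \<omega>|N. g \<omega> * iexp (t * Y \<omega>))"
    and A[measurable]: "A \<in> sets borel"
  shows "(\<integral>\<omega>. Re (h \<omega>) * indicator A (X \<omega>) \<partial>M) = (\<integral>\<omega>. Re (g \<omega>) * indicator A (Y \<omega>) \<partial>N)"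
proof -
  interpret M: prob_space M by fact
  interpret N: prob_space N by fact
  have Re_h: "\<bar>Re (h \<omega>)\<bar> \<le> 1" for \<omega> using abs_Re_le_cmod[of "h \<omega>"] h[of \<omega>] by linarith
  have Re_g: "\<bar>Re (g \<omega>)\<bar> \<le> 1" for \<omega> using abs_Re_le_cmod[of "g \<omega>"] g[of \<omega>] by linarith
  have iM: "integrable M f" if [measurable]: "f \<in> borel_measurable M" and "\<And>\<omega>. norm (f \<omega>) \<le> 1" for f :: "'a \<Rightarrow> complex"
    using that by (intro M.integrable_const_bound[where B=1]) auto
  have iN: "integrable N f" if [measurable]: "f \<in> borel_measurable N" and "\<And>\<omega>. norm (f \<omega>) \<le> 1" for f :: "'b \<Rightarrow> complex"
    using that by (intro N.integrable_const_bound[where B=1]) auto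
  \<comment> \<open>Conjugating the hypothesis at \<open>- t\<close> gives the transform of
    \<open>cnj h\<close> at \<open>t\<close>.\<close>
  have eq_cnj: "(CLINT \<omega>|M. cnj (h \<omega>) * iexp (t * X \<omega>)) = (CLINT \<omega>|N. cnj (g \<omega>) * iexp (t * Y \<omega>))" for t
  proof -
    have "(CLINT \<omega>|M. cnj (h \<omega> * iexp (- t * X \<omega>))) = (CLINT \<omega>|N. cnj (g \<omega> * iexp (- t * Y \<omega>)))"
      by (simp only: Bochner_Integration.integral_cnj eq)
    then show ?thesis by (simp add: exp_cnj)
  qed
  \<comment> \<open>Since Re z = (z + cnj z) / 2, the transform of \<open>1 + Re h\<close> is a
    combination of those of 1, \<open>h\<close> and \<open>cnj h\<close>.\<close>
  have split: "complex_of_real (1 + Re z) * w = w + (z * w + cnj z * w) / 2" for z w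
    using complex_add_cnj[of z] by (simp add: field_simps flip: distrib_left)
  have [measurable]: "cnj \<in> borel_measurable borel"
    by (intro borel_measurable_continuous_onI continuous_intros)
  have lin: "(CLINT x|P. a x + (b x + c x) / 2) = (CLINT x|P. a x) + ((CLINT x|P. b x) + (CLINT x|P. c x)) / 2"
    if "integrable P a" "integrable P b" "integrable P c" for P :: "'c measure" and a b c :: "'c \<Rightarrow> complex"
    using that by simp
  have "(CLINT \<omega>|M. complex_of_real (1 + Re (h \<omega>)) * iexp (t * X \<omega>)) =
        (CLINT \<omega>|N. complex_of_real (1 + Re (g \<omega>)) * iexp (t * Y \<omega>))" for t
  proof -
    have "(CLINT \<omega>|M. complex_of_real (1 + Re (h \<omega>)) * iexp (t * X \<omega>)) = 
      (CLINT \<omega>|M. iexp (t * X \<omega>)) +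
      ((CLINT \<omega>|M. h \<omega> * iexp (t * X \<omega>)) + (CLINT \<omega>|M. cnj (h \<omega>) * iexp (t * X \<omega>))) / 2"
      unfolding split
      by (rule lin; intro iM; simp add: norm_mult h)
    moreover have "(CLINT \<omega>|N. complex_of_real (1 + Re (g \<omega>)) * iexp (t * Y \<omega>)) = 
      (CLINT \<omega>|N. iexp (t * Y \<omega>)) +
      ((CLINT \<omega>|N. g \<omega> * iexp (t * Y \<omega>)) + (CLINT \<omega>|N. cnj (g \<omega>) * iexp (t * Y \<omega>))) / 2"
      unfolding split
      by (rule lin; intro iN; simp add: norm_mult g)
    ultimately show ?thesis
      by (simp only: eq1 eq eq_cnj)
  qed
  moreover have ih: "integrable M (\<lambda>\<omega>. Re (h \<omega>))" and ig: "integrable N (\<lambda>\<omega>. Re (g \<omega>))"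
    using Re_h Re_g by (auto intro!: M.integrable_const_bound[where B=1] N.integrable_const_bound[where B=1])
  moreover have "0 \<le> 1 + Re (h \<omega>)" "0 \<le> 1 + Re (g \<omega>')" for \<omega> \<omega>'
    using Re_h[of \<omega>] Re_g[of \<omega>'] by linarith+
  ultimately have *: "(\<integral>\<omega>. (1 + Re (h \<omega>)) * indicator A (X \<omega>) \<partial>M) = (\<integral>\<omega>. (1 + Re (g \<omega>)) * indicator A (Y \<omega>) \<partial>N)"
    by (intro weighted_law_eqI_nonneg) auto
  \<comment> \<open>The constant 1 is itself a nonnegative weight; its identity is subtracted from
    the one for \<open>1 + Re h\<close>.\<close>
  have "(\<integral>\<omega>. 1 * indicator A (X \<omega>) \<partial>M) = (\<integral>\<omega>. 1 * indicator A (Y \<omega>) \<partial>N :: real)"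
    using eq1 by (intro weighted_law_eqI_nonneg) auto
  moreover have "(\<integral>\<omega>. (1 + Re (h \<omega>)) * indicator A (X \<omega>) \<partial>M) =
      (\<integral>\<omega>. 1 * indicator A (X \<omega>) \<partial>M) + (\<integral>\<omega>. Re (h \<omega>) * indicator A (X \<omega>) \<partial>M)"
    unfolding distrib_right using ih
    by (intro Bochner_Integration.integral_add integrable_real_mult_indicator)
       (auto intro!: M.integrable_const_bound[where B=1] simp: abs_mult Re_h indicator_def)
  moreover have "(\<integral>\<omega>. (1 + Re (g \<omega>)) * indicator A (Y \<omega>) \<partial>N) =
      (\<integral>\<omega>. 1 * indicator A (Y \<omega>) \<partial>N) + (\<integral>\<omega>. Re (g \<omega>) * indicator A (Y \<omega>) \<partial>N)"
    unfolding distrib_right using ig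
    by (intro Bochner_Integration.integral_add integrable_real_mult_indicator)
       (auto intro!: N.integrable_const_bound[where B=1] simp: abs_mult Re_g indicator_def)
  ultimately show ?thesis
    using * by linarith
qed

text \<open>Multiplication by \<open>- \<i>\<close> preserves the norm and moves the imaginary part
  into the real part, so the result for real parts is applied twice.\<close>

lemma weighted_law_eqI:
  fixes h :: "'a \<Rightarrow> complex" and g :: "'b \<Rightarrow> complex"
  assumes PM: "prob_space M" and PN: "prob_space N"
    and [measurable]: "X \<in> borel_measurable M" "Y \<in> borel_measurable N"
    and [measurable]: "h \<in> borel_measurable M" "g \<in> borel_measurable N"
    and h: "\<And>\<omega>. norm (h \<omega>) \<le> 1" and g: "\<And>\<omega>. norm (g \<omega>) \<le> 1"
    and eq1: "\<And>t. (CLINT \<omega>|M. iexp (t * X \<omega>)) = (CLINT \<omega>|N. iexp (t * Y \<omega>))"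
    and eq: "\<And>t. (CLINT \<omega>|M. h \<omega> * iexp (t * X \<omega>)) = (CLINT \<omega>|N. g \<omega> * iexp (t * Y \<omega>))"
    and A[measurable]: "A \<in> sets borel"
  shows "(CLINT \<omega>|M. h \<omega> * indicator A (X \<omega>)) = (CLINT \<omega>|N. g \<omega> * indicator A (Y \<omega>))"
proof -
  interpret M: prob_space M by fact
  interpret N: prob_space N by fact
  have Re: "(\<integral>\<omega>. Re (h \<omega>) * indicator A (X \<omega>) \<partial>M) = (\<integral>\<omega>. Re (g \<omega>) * indicator A (Y \<omega>) \<partial>N)"
    using PM PN h g eq1 eq by (intro weighted_law_eqI_Re) auto
  have "(CLINT \<omega>|M. (- \<i> * h \<omega>) * iexp (t * X \<omega>)) = (CLINT \<omega>|N. (- \<i> * g \<omega>) * iexp (t * Y \<omega>))" for t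
    using eq[of t] by (simp only: mult.assoc integral_mult_right_zero)
  then have "(\<integral>\<omega>. Re (- \<i> * h \<omega>) * indicator A (X \<omega>) \<partial>M) = (\<integral>\<omega>. Re (- \<i> * g \<omega>) * indicator A (Y \<omega>) \<partial>N)"
    using PM PN h g eq1 by (intro weighted_law_eqI_Re) (auto simp: norm_mult)
  then have Im: "(\<integral>\<omega>. Im (h \<omega>) * indicator A (X \<omega>) \<partial>M) = (\<integral>\<omega>. Im (g \<omega>) * indicator A (Y \<omega>) \<partial>N)"
    by simp
  have "integrable M (\<lambda>\<omega>. h \<omega> * indicator A (X \<omega>))" "integrable N (\<lambda>\<omega>. g \<omega> * indicator A (Y \<omega>))"
    using h g by (auto intro!: M.integrable_const_bound[where B=1] N.integrable_const_bound[where B=1]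
      simp: norm_mult indicator_def)
  moreover have "Re (z * indicator A x) = Re z * indicator A x" "Im (z * indicator A x) = Im z * indicator A x" for z and x :: real
    by (auto simp: indicator_def)
  ultimately show ?thesis
    using Re Im by (intro complex_eqI) (simp_all flip: integral_Re integral_Im)
qed

section \<open>The Cramer-Wold device\<close>

text \<open>Integrating \<open>iexp\<close> against the laws in \<open>eq\<close> gives equal joint
  characteristic functions. The probability of a box is the integral of a product of indicators, and
  boxes determine a finite measure on the product space.\<close>

lemma cramer_wold:
  fixes X :: "'i \<Rightarrow> 'a \<Rightarrow> real" and Y :: "'i \<Rightarrow> 'b \<Rightarrow> real"
  assumes PM: "prob_space M" and PN: "prob_space N" and S: "finite S"
    and X: "\<And>i. i \<in> S \<Longrightarrow> X i \<in> borel_measurable M" 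
    and Y: "\<And>i. i \<in> S \<Longrightarrow> Y i \<in> borel_measurable N"
    and eq: "\<And>u. distr M borel (\<lambda>\<omega>. \<Sum>i\<in>S. u i * X i \<omega>) = distr N borel (\<lambda>\<omega>. \<Sum>i\<in>S. u i * Y i \<omega>)"
  shows "distr M (Pi\<^sub>M S (\<lambda>_. borel)) (\<lambda>\<omega>. \<lambda>i\<in>S. X i \<omega>) =
         distr N (Pi\<^sub>M S (\<lambda>_. borel)) (\<lambda>\<omega>. \<lambda>i\<in>S. Y i \<omega>)"
proof -
  interpret M: prob_space M by fact
  interpret N: prob_space N by fact
  have char_eq: "(CLINT \<omega>|M. iexp (\<Sum>i\<in>S. u i * X i \<omega>)) = (CLINT \<omega>|N. iexp (\<Sum>i\<in>S. u i * Y i \<omega>))" for u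
  proof -
    have "(CLINT \<omega>|M. iexp (\<Sum>i\<in>S. u i * X i \<omega>)) = (CLINT x|distr M borel (\<lambda>\<omega>. \<Sum>i\<in>S. u i * X i \<omega>). iexp x)"
      using X by (subst integral_distr) auto
    also have "\<dots> = (CLINT \<omega>|N. iexp (\<Sum>i\<in>S. u i * Y i \<omega>))"
      unfolding eq using Y by (subst integral_distr) auto
    finally show ?thesis .
  qed
  (* The characters are traded for indicators one coordinate at a time; the part not yet treated is the
     complex weight of the one-dimensional uniqueness theorem. *)
  have mixed: "(CLINT \<omega>|M. (\<Prod>i\<in>J. indicator (A i) (X i \<omega>)) * iexp (\<Sum>i\<in>S - J. u i * X i \<omega>)) =
               (CLINT \<omega>|N. (\<Prod>i\<in>J. indicator (A i) (Y i \<omega>)) * iexp (\<Sum>i\<in>S - J. u i * Y i \<omega>))"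
    if "J \<subseteq> S" and A: "\<And>i. i \<in> S \<Longrightarrow> A i \<in> sets borel" for J A u
  proof -
    from \<open>J \<subseteq> S\<close> S have "finite J" by (rule finite_subset)
    then show ?thesis
      using \<open>J \<subseteq> S\<close>
    \<comment> \<open>\<open>u\<close> is generalised because the coefficient of the coordinate
      \<open>j\<close> that leaves the exponential becomes the free variable \<open>t\<close> of the
      one-dimensional transform: the induction hypothesis is used for every
      \<open>u(j := t)\<close>.\<close>
    proof (induction J arbitrary: u rule: finite_induct)
      case empty
      then show ?case using char_eq by simp
    next
      case (insert j J)
      then have j: "j \<in> S" "J \<subseteq> S" "S - J = insert j (S - insert j J)" by auto
      have sum_upd: "(\<Sum>i\<in>S - J. (u(j := t)) i * Z i) = (\<Sum>i\<in>S - insert j J. u i * Z i) + t * Z j"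
        for t and Z :: "'i \<Rightarrow> real"
        unfolding j(3) using S by simp
      \<comment> \<open>Coefficients supported at \<open>j\<close> alone give the unweighted
        transform of that coordinate, which the one-dimensional theorem also asks for.\<close>
      have sum_single: "(\<Sum>i\<in>S. ((\<lambda>_. 0)(j := t)) i * Z i) = t * Z j" for t and Z :: "'i \<Rightarrow> real"
        using S j(1) by (simp add: sum.remove[of S j])
      have [measurable]: "X j \<in> borel_measurable M" "Y j \<in> borel_measurable N" "A j \<in> sets borel"
        using X Y A j by auto
      have [measurable]: "A i \<in> sets borel" "X i \<in> borel_measurable M" "Y i \<in> borel_measurable N" if "i \<in> J" for i
        using A X Y j that by auto
      have [measurable]: "X i \<in> borel_measurable M" "Y i \<in> borel_measurable N" if "i \<in> S - insert j J" for i
        using X Y that by auto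
      let ?h = "\<lambda>\<omega>. (\<Prod>i\<in>J. indicator (A i) (X i \<omega>)) * iexp (\<Sum>i\<in>S - insert j J. u i * X i \<omega>)"
      let ?g = "\<lambda>\<omega>. (\<Prod>i\<in>J. indicator (A i) (Y i \<omega>)) * iexp (\<Sum>i\<in>S - insert j J. u i * Y i \<omega>)"
      have bound: "norm ((\<Prod>i\<in>J. indicator (A i) (Z i)) * iexp s) \<le> 1" for Z :: "'i \<Rightarrow> real" and s :: real
        by (auto simp: norm_mult prod_norm[symmetric] indicator_def intro!: prod_le_1)
      have "(CLINT \<omega>|M. ?h \<omega> * indicator (A j) (X j \<omega>)) = (CLINT \<omega>|N. ?g \<omega> * indicator (A j) (Y j \<omega>))"
      proof (rule weighted_law_eqI[OF PM PN])
        show "?h \<in> borel_measurable M" "?g \<in> borel_measurable N"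
          by measurable
        show "(CLINT \<omega>|M. iexp (t * X j \<omega>)) = (CLINT \<omega>|N. iexp (t * Y j \<omega>))" for t
          using char_eq[of "(\<lambda>_. 0)(j := t)"] by (simp only: sum_single)
        show "(CLINT \<omega>|M. ?h \<omega> * iexp (t * X j \<omega>)) = (CLINT \<omega>|N. ?g \<omega> * iexp (t * Y j \<omega>))" for t
          using insert.IH[OF j(2), of "u(j := t)"]
          by (simp only: sum_upd of_real_add distrib_left exp_add mult.assoc)
        show "norm (?h \<omega>) \<le> 1" "norm (?g \<omega>') \<le> 1" for \<omega> \<omega>'
          by (rule bound)+
      qed simp_all
      then show ?case
        using insert.hyps by (simp add: ac_simps)
    qed
  qed
  have meas[measurable]: "(\<lambda>\<omega>. \<lambda>i\<in>S. X i \<omega>) \<in> M \<rightarrow>\<^sub>M Pi\<^sub>M S (\<lambda>_. borel)" "(\<lambda>\<omega>. \<lambda>i\<in>S. Y i \<omega>) \<in> N \<rightarrow>\<^sub>M Pi\<^sub>M S (\<lambda>_. borel)"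
    using X Y by (auto intro: measurable_restrict)
  show ?thesis
  proof (rule measure_eqI_PiM_finite[OF S])
    fix A assume A: "\<And>i. i \<in> S \<Longrightarrow> A i \<in> sets (borel :: real measure)"
    have E[measurable]: "Pi\<^sub>E S A \<in> sets (Pi\<^sub>M S (\<lambda>_. borel))"
      using A S by (intro sets_PiM_I_finite)
    have ind: "(\<Prod>i\<in>S. indicator (A i) (Z i \<omega>)) = complex_of_real (indicator ((\<lambda>\<omega>. \<lambda>i\<in>S. Z i \<omega>) -` Pi\<^sub>E S A \<inter> space P) \<omega>)"
      if "\<omega> \<in> space P" for Z \<omega> and P :: "'c measure"
      using S that by (auto simp: indicator_def PiE_def Pi_def)
    have "complex_of_real (measure M ((\<lambda>\<omega>. \<lambda>i\<in>S. X i \<omega>) -` Pi\<^sub>E S A \<inter> space M)) =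
          (CLINT \<omega>|M. (\<Prod>i\<in>S. indicator (A i) (X i \<omega>)))"
      by (simp add: ind del: of_real_indicator cong: Bochner_Integration.integral_cong)
    also have "\<dots> = (CLINT \<omega>|N. (\<Prod>i\<in>S. indicator (A i) (Y i \<omega>)))"
      using mixed[of S A] A by simp
    also have "\<dots> = complex_of_real (measure N ((\<lambda>\<omega>. \<lambda>i\<in>S. Y i \<omega>) -` Pi\<^sub>E S A \<inter> space N))"
      by (simp add: ind del: of_real_indicator cong: Bochner_Integration.integral_cong)
    finally show "emeasure (distr M (Pi\<^sub>M S (\<lambda>_. borel)) (\<lambda>\<omega>. \<lambda>i\<in>S. X i \<omega>)) (Pi\<^sub>E S A) =
                  emeasure (distr N (Pi\<^sub>M S (\<lambda>_. borel)) (\<lambda>\<omega>. \<lambda>i\<in>S. Y i \<omega>)) (Pi\<^sub>E S A)"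
      by (simp add: emeasure_distr M.emeasure_eq_measure N.emeasure_eq_measure)
  next
    \<comment> \<open>The full space is itself a box of finite measure, so a constant sequence
      exhausts it.\<close>
    show "range (\<lambda>_::nat. \<Pi>\<^sub>E i\<in>S. UNIV) \<subseteq> prod_algebra S (\<lambda>_. borel)"
      using S by (auto intro!: prod_algebraI_finite)
    show "(\<Union>i::nat. \<Pi>\<^sub>E i\<in>S. UNIV) = space (Pi\<^sub>M S (\<lambda>_. borel))"
      by (simp add: space_PiM)
    show "emeasure (distr M (Pi\<^sub>M S (\<lambda>_. borel)) (\<lambda>\<omega>. \<lambda>i\<in>S. X i \<omega>)) (\<Pi>\<^sub>E i\<in>S. UNIV) \<noteq> \<infinity>" for i :: nat
      using finite_measure.emeasure_finite[OF prob_space.finite_measure[OF M.prob_space_distr[OF meas(1)]]] by simp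
  qed simp_all
qed

section \<open>Normal variables and Gaussian vectors\<close>

text \<open>The variance tells the two kinds of normal variable apart: it is 0 for a constant and
  \<open>\<sigma>\<^sup>2 > 0\<close> for a density, so the mixed cases are contradictory. Within
  one kind, mean and variance fix the parameters.\<close>

lemma normal_rv_distr_eqI:
  assumes PM: "prob_space M" and PN: "prob_space N"
    and meas: "Y \<in> borel_measurable M" "Z \<in> borel_measurable N"
    and nY: "normal_rv M Y" and nZ: "normal_rv N Z"
    and mean: "prob_space.expectation M Y = prob_space.expectation N Z"
    and var: "prob_space.variance M Y = prob_space.variance N Z"
  shows "distr M borel Y = distr N borel Z"
proof -
  interpret M: prob_space M by fact
  interpret N: prob_space N by fact
  have const: "prob_space.expectation P W = c" "prob_space.variance P W = 0" "distr P borel W = return borel c"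
    if "prob_space P" and [measurable]: "W \<in> borel_measurable P" and ae: "AE \<omega> in P. W \<omega> = c"
    for P :: "'c measure" and W :: "'c \<Rightarrow> real" and c
  proof -
    interpret P: prob_space P by fact
    have "P.expectation W = P.expectation (\<lambda>_. c)"
      using ae by (intro integral_cong_AE) auto
    then show "P.expectation W = c" by (simp add: P.prob_space)
    then have "P.variance W = P.expectation (\<lambda>_. 0)"
      using ae by (intro integral_cong_AE) auto
    then show "P.variance W = 0" by simp
    have "distr P borel W = distr P borel (\<lambda>_. c)"
      using ae by (intro distr_cong_AE) auto
    then show "distr P borel W = return borel c" by simp
  qed
  have normal: "prob_space.expectation P W = \<mu>" "prob_space.variance P W = \<sigma>\<^sup>2" "distr P borel W = density lborel (normal_density \<mu> \<sigma>)"
    if "prob_space P" "0 < \<sigma>" and D: "distributed P lborel W (normal_density \<mu> \<sigma>)"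
    for P :: "'c measure" and W :: "'c \<Rightarrow> real" and \<mu> \<sigma>
  proof -
    interpret P: prob_space P by fact
    show "P.expectation W = \<mu>" "P.variance W = \<sigma>\<^sup>2"
      using P.normal_distributed_expectation P.normal_distributed_variance that by auto
    have "distr P borel W = distr P lborel W" by (rule distr_cong) auto
    then show "distr P borel W = density lborel (normal_density \<mu> \<sigma>)"
      using distributed_distr_eq_density[OF D] by simp
  qed
  show ?thesis
    using nY nZ unfolding normal_rv_def
  proof (elim disjE exE conjE)
    fix c d assume "AE \<omega> in M. Y \<omega> = c" "AE \<omega> in N. Z \<omega> = d"
    then show ?thesis
      using const(1,3)[OF PM meas(1)] const(1,3)[OF PN meas(2)] mean by simp
  next
    fix c \<mu> \<sigma> assume "AE \<omega> in M. Y \<omega> = c" "0 < \<sigma>" "distributed N lborel Z (normal_density \<mu> \<sigma>)"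
    then have "prob_space.variance M Y = 0" "prob_space.variance N Z = \<sigma>\<^sup>2" "\<sigma> \<noteq> 0"
      using const(2)[OF PM meas(1)] normal(2)[OF PN] by blast+
    then show ?thesis using var by simp
  next
    fix c \<mu> \<sigma> assume "AE \<omega> in N. Z \<omega> = c" "0 < \<sigma>" "distributed M lborel Y (normal_density \<mu> \<sigma>)"
    then have "prob_space.variance N Z = 0" "prob_space.variance M Y = \<sigma>\<^sup>2" "\<sigma> \<noteq> 0"
      using const(2)[OF PN meas(2)] normal(2)[OF PM] by blast+
    then show ?thesis using var by simp
  next
    fix \<mu> \<sigma> \<mu>' \<sigma>'
    assume D: "0 < \<sigma>" "distributed M lborel Y (normal_density \<mu> \<sigma>)"
      "0 < \<sigma>'" "distributed N lborel Z (normal_density \<mu>' \<sigma>')"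
    then have "\<mu> = \<mu>'" "\<sigma>\<^sup>2 = \<sigma>'\<^sup>2"
      using normal(1,2)[OF PM D(1,2)] normal(1,2)[OF PN D(3,4)] mean var by simp_all
    moreover from this(2) D have "\<sigma> = \<sigma>'" by simp
    ultimately show ?thesis
      using normal(3)[OF PM D(1,2)] normal(3)[OF PN D(3,4)] by simp
  qed
qed

lemma normal_rv_integrable_power:
  assumes PM: "prob_space M" and [measurable]: "Y \<in> borel_measurable M" and nY: "normal_rv M Y"
  shows "integrable M (\<lambda>\<omega>. Y \<omega> ^ n)"
proof -
  interpret M: prob_space M by fact
  show ?thesis
    using nY unfolding normal_rv_def
  proof (elim disjE exE conjE)
    fix \<mu> \<sigma> assume \<sigma>: "0 < \<sigma>" and D: "distributed M lborel Y (normal_density \<mu> \<sigma>)"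
    \<comment> \<open>Binomial expansion of \<open>((x - \<mu>) + \<mu>) ^ n\<close>, which reduces
      the claim to central moments.\<close>
    have "integrable lborel (\<lambda>x. \<Sum>k\<le>n. real (n choose k) * \<mu> ^ (n - k) * (normal_density \<mu> \<sigma> x * (x - \<mu>) ^ k))"
      using \<sigma> by (intro Bochner_Integration.integrable_sum integrable_mult_right integrable_normal_moment)
    moreover have "(\<Sum>k\<le>n. real (n choose k) * \<mu> ^ (n - k) * (normal_density \<mu> \<sigma> x * (x - \<mu>) ^ k)) =
        normal_density \<mu> \<sigma> x * x ^ n" for x
      using binomial_ring[of "x - \<mu>" \<mu> n] by (simp add: sum_distrib_left ac_simps)
    ultimately have "integrable lborel (\<lambda>x. normal_density \<mu> \<sigma> x * x ^ n)" by simp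
    then show ?thesis
      using distributed_integrable[OF D, of "\<lambda>x. x ^ n"] by simp
  next
    fix c assume "AE \<omega> in M. Y \<omega> = c"
    then have "integrable M (\<lambda>\<omega>. Y \<omega> ^ n) \<longleftrightarrow> integrable M (\<lambda>_. c ^ n)"
      by (intro integrable_cong_AE) auto
    then show ?thesis by simp
  qed
qed

lemma gaussian_vectorD:
  assumes "gaussian_vector M k X"
  shows "prob_space M" and "i < k \<Longrightarrow> X i \<in> borel_measurable M"
    and "S \<subseteq> {..<k} \<Longrightarrow> normal_rv M (\<lambda>\<omega>. \<Sum>i\<in>S. u i * X i \<omega>)"
    and "i < k \<Longrightarrow> normal_rv M (X i)"
proof -
  show "prob_space M" and "i < k \<Longrightarrow> X i \<in> borel_measurable M"
    using assms by (auto simp: gaussian_vector_def)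
  show sub: "normal_rv M (\<lambda>\<omega>. \<Sum>i\<in>S. u i * X i \<omega>)" if "S \<subseteq> {..<k}" for S u
  proof -
    have "(\<Sum>i<k. (if i \<in> S then u i else 0) * X i \<omega>) = (\<Sum>i\<in>S. u i * X i \<omega>)" for \<omega>
      using that by (intro sum.mono_neutral_cong_right) auto
    note sums = this
    have "normal_rv M (\<lambda>\<omega>. \<Sum>i<k. v i * X i \<omega>)" for v
      using assms by (simp add: gaussian_vector_def)
    from this[of "\<lambda>i. if i \<in> S then u i else 0"]
    show ?thesis unfolding sums .
  qed
  show "normal_rv M (X i)" if "i < k"
    using sub[of "{i}" "\<lambda>_. 1"] that by simp
qed

lemma gaussian_vector_scale:
  assumes "gaussian_vector M k X"
  shows "gaussian_vector M k (\<lambda>i \<omega>. c i * X i \<omega>)"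
  unfolding gaussian_vector_def
proof (intro conjI allI impI)
  fix u :: "nat \<Rightarrow> real"
  show "normal_rv M (\<lambda>\<omega>. \<Sum>i<k. u i * (c i * X i \<omega>))"
    using gaussian_vectorD(3)[OF assms order_refl, of "\<lambda>i. u i * c i"] by (simp add: mult.assoc)
qed (use gaussian_vectorD(1,2)[OF assms] in auto)

lemma gaussian_vector_integrable:
  assumes G: "gaussian_vector M k X" and "i < k"
  shows "integrable M (X i)"
  using normal_rv_integrable_power[of M "X i" 1] gaussian_vectorD(1,2,4)[OF G] \<open>i < k\<close> by simp

text \<open>Domination by the sum of squares. Expanding the variance of a linear combination into
  second moments rests on this, since linearity of the Bochner integral needs integrable
  summands.\<close>

lemma gaussian_vector_integrable_mult:
  assumes G: "gaussian_vector M k X" and i: "i < k" and j: "j < k"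
  shows "integrable M (\<lambda>\<omega>. X i \<omega> * X j \<omega>)"
proof (rule Bochner_Integration.integrable_bound)
  note [measurable] = gaussian_vectorD(2)[OF G i] gaussian_vectorD(2)[OF G j]
  show "integrable M (\<lambda>\<omega>. (X i \<omega>)\<^sup>2 + (X j \<omega>)\<^sup>2)"
    using gaussian_vectorD(1,2,4)[OF G] i j
    by (intro Bochner_Integration.integrable_add normal_rv_integrable_power)
  show "(\<lambda>\<omega>. X i \<omega> * X j \<omega>) \<in> borel_measurable M" by measurable
  have "\<bar>x * y\<bar> \<le> x\<^sup>2 + y\<^sup>2" for x y :: real
  proof -
    have "2 * \<bar>x * y\<bar> \<le> x\<^sup>2 + y\<^sup>2"
      using sum_squares_bound[of "\<bar>x\<bar>" "\<bar>y\<bar>"] by (simp add: abs_mult)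
    then show ?thesis using abs_ge_zero[of "x * y"] by linarith
  qed
  then show "AE \<omega> in M. norm (X i \<omega> * X j \<omega>) \<le> norm ((X i \<omega>)\<^sup>2 + (X j \<omega>)\<^sup>2)"
    by simp
qed

lemma gaussian_vector_sum_moments:
  assumes G: "gaussian_vector M k X" and C: "centered M k X" and S: "S \<subseteq> {..<k}"
  shows "prob_space.expectation M (\<lambda>\<omega>. \<Sum>i\<in>S. u i * X i \<omega>) = 0"
    and "prob_space.variance M (\<lambda>\<omega>. \<Sum>i\<in>S. u i * X i \<omega>) =
      (\<Sum>i\<in>S. \<Sum>j\<in>S. u i * u j * (\<integral>\<omega>. X i \<omega> * X j \<omega> \<partial>M))"
proof -
  have less: "i < k" if "i \<in> S" for i using S that by auto
  show E: "prob_space.expectation M (\<lambda>\<omega>. \<Sum>i\<in>S. u i * X i \<omega>) = 0"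
    using C gaussian_vector_integrable[OF G] less
    by (simp add: Bochner_Integration.integral_sum centered_def)
  have "(\<integral>\<omega>. (\<Sum>i\<in>S. u i * X i \<omega>)\<^sup>2 \<partial>M) =
    (\<integral>\<omega>. (\<Sum>i\<in>S. \<Sum>j\<in>S. u i * u j * (X i \<omega> * X j \<omega>)) \<partial>M)"
    by (simp add: power2_eq_square sum_product ac_simps)
  also have "\<dots> = (\<Sum>i\<in>S. \<Sum>j\<in>S. u i * u j * (\<integral>\<omega>. X i \<omega> * X j \<omega> \<partial>M))"
    using gaussian_vector_integrable_mult[OF G] less
    by (simp add: Bochner_Integration.integral_sum)
  finally show "prob_space.variance M (\<lambda>\<omega>. \<Sum>i\<in>S. u i * X i \<omega>) =
      (\<Sum>i\<in>S. \<Sum>j\<in>S. u i * u j * (\<integral>\<omega>. X i \<omega> * X j \<omega> \<partial>M))"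
    by (simp add: E)
qed

text \<open>The variance of a linear combination over \<open>S\<close> is a quadratic form in the
  second moments indexed by \<open>S\<close>, so agreement on \<open>S\<close> suffices; the vectors
  may be correlated differently elsewhere.\<close>

lemma gaussian_vector_law_eqI:
  assumes GX: "gaussian_vector M k X" "centered M k X" and GY: "gaussian_vector N k Y" "centered N k Y"
    and S: "S \<subseteq> {..<k}"
    and cov: "\<And>i j. i \<in> S \<Longrightarrow> j \<in> S \<Longrightarrow> (\<integral>\<omega>. X i \<omega> * X j \<omega> \<partial>M) = (\<integral>\<omega>. Y i \<omega> * Y j \<omega> \<partial>N)"
  shows "distr M (Pi\<^sub>M S (\<lambda>_. borel)) (\<lambda>\<omega>. \<lambda>i\<in>S. X i \<omega>) =
         distr N (Pi\<^sub>M S (\<lambda>_. borel)) (\<lambda>\<omega>. \<lambda>i\<in>S. Y i \<omega>)"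
proof (rule cramer_wold)
  show P: "prob_space M" "prob_space N"
    by (fact gaussian_vectorD(1)[OF GX(1)], fact gaussian_vectorD(1)[OF GY(1)])
  show fin: "finite S" using S by (rule finite_subset) simp
  show meas: "X i \<in> borel_measurable M" "Y i \<in> borel_measurable N" if "i \<in> S" for i
    using S that by (auto intro: gaussian_vectorD(2)[OF GX(1)] gaussian_vectorD(2)[OF GY(1)])
  fix u
  show "distr M borel (\<lambda>\<omega>. \<Sum>i\<in>S. u i * X i \<omega>) = distr N borel (\<lambda>\<omega>. \<Sum>i\<in>S. u i * Y i \<omega>)"
  proof (rule normal_rv_distr_eqI[OF P])
    show "(\<lambda>\<omega>. \<Sum>i\<in>S. u i * X i \<omega>) \<in> borel_measurable M" "(\<lambda>\<omega>. \<Sum>i\<in>S. u i * Y i \<omega>) \<in> borel_measurable N"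
      using meas by auto
    show "normal_rv M (\<lambda>\<omega>. \<Sum>i\<in>S. u i * X i \<omega>)" "normal_rv N (\<lambda>\<omega>. \<Sum>i\<in>S. u i * Y i \<omega>)"
      by (fact gaussian_vectorD(3)[OF GX(1) S], fact gaussian_vectorD(3)[OF GY(1) S])
    show "prob_space.expectation M (\<lambda>\<omega>. \<Sum>i\<in>S. u i * X i \<omega>) =
      prob_space.expectation N (\<lambda>\<omega>. \<Sum>i\<in>S. u i * Y i \<omega>)"
      unfolding gaussian_vector_sum_moments(1)[OF GX S] gaussian_vector_sum_moments(1)[OF GY S] ..
    show "prob_space.variance M (\<lambda>\<omega>. \<Sum>i\<in>S. u i * X i \<omega>) =
      prob_space.variance N (\<lambda>\<omega>. \<Sum>i\<in>S. u i * Y i \<omega>)"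
      by (subst gaussian_vector_sum_moments(2)[OF GX S], subst gaussian_vector_sum_moments(2)[OF GY S])
         (simp add: cov)
  qed
qed

lemma correlation_matrix_index:
  assumes "centered M k X" "unit_variances M k X" "i < k" "j < k"
  shows "correlation_matrix M k X $$ (i, j) = (\<integral>\<omega>. X i \<omega> * X j \<omega> \<partial>M)"
  using assms by (simp add: correlation_matrix_def covariance_def centered_def unit_variances_def)

section \<open>Absolute product moments and their finiteness\<close>

text \<open>As an identity of extended reals it carries equality of laws over to moments without
  deciding whether they are finite.\<close>

lemma abs_product_moment_eq_nn_integral_law:
  assumes "finite S" "\<And>i. i \<in> S \<Longrightarrow> X i \<in> borel_measurable M"
  shows "abs_product_moment M X S p =
    (\<integral>\<^sup>+x. ennreal (\<Prod>i\<in>S. \<bar>x i\<bar> powr p i) \<partial>distr M (Pi\<^sub>M S (\<lambda>_. borel)) (\<lambda>\<omega>. \<lambda>i\<in>S. X i \<omega>))"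
proof -
  have [measurable]: "(\<lambda>\<omega>. \<lambda>i\<in>S. X i \<omega>) \<in> M \<rightarrow>\<^sub>M Pi\<^sub>M S (\<lambda>_. borel)"
    using assms by (auto intro: measurable_restrict)
  show ?thesis
    unfolding abs_product_moment_def by (subst nn_integral_distr) (auto cong: prod.cong)
qed

text \<open>Every factor is at most the largest one, whose power is among the summands. The summand
  1 accounts for the empty product. This does the work of Hoelder's inequality in reducing mixed
  moments to moments of single coordinates.\<close>

lemma prod_le_one_plus_sum_power_card:
  fixes a :: "'i \<Rightarrow> real"
  assumes "finite S" "\<And>i. i \<in> S \<Longrightarrow> 0 \<le> a i"
  shows "(\<Prod>i\<in>S. a i) \<le> 1 + (\<Sum>i\<in>S. a i ^ card S)"
proof (cases "S = {}")
  case False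
  then have "Max (a ` S) \<in> a ` S"
    using assms(1) by (intro Max_in) auto
  then obtain j where "j \<in> S" "Max (a ` S) = a j" by auto
  then have j: "j \<in> S" "\<And>i. i \<in> S \<Longrightarrow> a i \<le> a j"
    using Max_ge[of "a ` S"] assms(1) by auto
  have "(\<Prod>i\<in>S. a i) \<le> (\<Prod>i\<in>S. a j)"
    using j assms by (intro prod_mono) auto
  also have "\<dots> \<le> (\<Sum>i\<in>S. a i ^ card S)"
    using j assms by (auto intro!: member_le_sum)
  finally show ?thesis by simp
qed simp

text \<open>Reduces real exponents to integer ones: the first summand dominates where
  \<open>\<bar>x\<bar> \<le> 1\<close>, the second elsewhere. The even power removes the absolute
  value.\<close>

lemma abs_powr_le_one_plus_even_power:
  fixes x q :: real
  assumes "0 \<le> q" "q \<le> 2 * real m"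
  shows "\<bar>x\<bar> powr q \<le> 1 + x ^ (2 * m)"
proof (cases "\<bar>x\<bar> \<le> 1")
  case True
  then have "\<bar>x\<bar> powr q \<le> 1"
    using assms by (intro powr_le1) auto
  then show ?thesis by (simp add: add_increasing2)
next
  case False
  then have "\<bar>x\<bar> powr q \<le> \<bar>x\<bar> powr real (2 * m)"
    using assms by (intro powr_mono) auto
  also have "\<dots> = x ^ (2 * m)"
    using False by (subst powr_realpow) (auto simp: power_even_abs)
  finally show ?thesis by simp
qed

lemma gaussian_vector_abs_product_moment_finite:
  assumes G: "gaussian_vector M k X" and S: "S \<subseteq> {..<k}" and p: "\<And>i. i \<in> S \<Longrightarrow> 0 \<le> p i"
  shows "abs_product_moment M X S p < \<infinity>"
proof -
  interpret prob_space M using gaussian_vectorD(1)[OF G] .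
  have fin: "finite S" using S by (rule finite_subset) simp
  \<comment> \<open>All that matters is \<open>p i * card S \<le> 2 * m i\<close>; the ceiling is a
    convenient such integer.\<close>
  define m where "m i = nat \<lceil>p i * real (card S)\<rceil>" for i
  have m: "p i * real (card S) \<le> 2 * real (m i)" if "i \<in> S" for i
  proof -
    have "p i * real (card S) \<le> real (m i)"
      unfolding m_def by (rule real_nat_ceiling_ge)
    then show ?thesis by simp
  qed
  have bound: "(\<Prod>i\<in>S. \<bar>X i \<omega>\<bar> powr p i) \<le> 1 + (\<Sum>i\<in>S. 1 + X i \<omega> ^ (2 * m i))" for \<omega>
  proof -
    have "(\<Prod>i\<in>S. \<bar>X i \<omega>\<bar> powr p i) \<le> 1 + (\<Sum>i\<in>S. (\<bar>X i \<omega>\<bar> powr p i) ^ card S)"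
      using fin by (rule prod_le_one_plus_sum_power_card) simp
    also have "(\<Sum>i\<in>S. (\<bar>X i \<omega>\<bar> powr p i) ^ card S) \<le> (\<Sum>i\<in>S. 1 + X i \<omega> ^ (2 * m i))"
    proof (rule sum_mono)
      fix i assume i: "i \<in> S"
      \<comment> \<open>Since \<open>0 powr q = 0\<close> for every \<open>q\<close>, the case
        \<open>X i \<omega> = 0\<close> of the next equation depends on a positive exponent:
        \<open>0 ^ 0\<close> would be 1.\<close>
      then have "card S \<noteq> 0" using fin by auto
      then have "(\<bar>X i \<omega>\<bar> powr p i) ^ card S = \<bar>X i \<omega>\<bar> powr (p i * real (card S))"
        by (cases "X i \<omega> = 0") (simp_all add: powr_power mult.commute)
      also have "\<dots> \<le> 1 + X i \<omega> ^ (2 * m i)"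
        using p[OF i] m[OF i] by (intro abs_powr_le_one_plus_even_power) auto
      finally show "(\<bar>X i \<omega>\<bar> powr p i) ^ card S \<le> 1 + X i \<omega> ^ (2 * m i)" .
    qed
    finally show ?thesis by simp
  qed
  have int: "integrable M (\<lambda>\<omega>. 1 + (\<Sum>i\<in>S. 1 + X i \<omega> ^ (2 * m i)))"
    using S gaussian_vectorD(1,2,4)[OF G]
    by (intro Bochner_Integration.integrable_add Bochner_Integration.integrable_sum normal_rv_integrable_power) auto
  have "abs_product_moment M X S p \<le> (\<integral>\<^sup>+\<omega>. ennreal (1 + (\<Sum>i\<in>S. 1 + X i \<omega> ^ (2 * m i))) \<partial>M)"
    unfolding abs_product_moment_def by (intro nn_integral_mono ennreal_leI bound)
  also have "\<dots> < \<infinity>"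
    using int by (subst nn_integral_eq_integral) (auto intro!: add_nonneg_nonneg sum_nonneg)
  finally show ?thesis .
qed

section \<open>The two sign patterns on the 4-cycle\<close>

lemma Sigma_carrier: "Sigma_plus \<in> carrier_mat 4 4" "Sigma_minus \<in> carrier_mat 4 4"
  by (auto intro!: carrier_matI simp: Sigma_plus_def Sigma_minus_def Let_def mat_of_rows_list_def)

lemma lessThan_4: "{..<4::nat} = {0, 1, 2, 3}"
  by auto

text \<open>The edges of the cycle 0-1-2-3-0 are exactly the pairs with odd index sum; {0, 3} is the
  edge whose sign changes.\<close>

lemma Sigma_index:
  assumes "i < 4" "j < 4"
  shows "Sigma_plus $$ (i, j) =
      (if i = j then 1 else if odd (i + j) then 2/5 else 0)"
    and "Sigma_minus $$ (i, j) =
      (if i = j then 1 else if {i, j} = {0, 3} then - 2/5 else if odd (i + j) then 2/5 else 0)"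
proof -
  have "i \<in> {0, 1, 2, 3}" "j \<in> {0, 1, 2, 3}"
    using assms by (auto simp flip: lessThan_4)
  then show "Sigma_plus $$ (i, j) =
      (if i = j then 1 else if odd (i + j) then 2/5 else 0)"
    and "Sigma_minus $$ (i, j) =
      (if i = j then 1 else if {i, j} = {0, 3} then - 2/5 else if odd (i + j) then 2/5 else 0)"
    by (auto simp: Sigma_plus_def Sigma_minus_def Let_def mat_of_rows_list_def doubleton_eq_iff)
qed

lemma Sigma_symmetric: "transpose_mat Sigma_plus = Sigma_plus" "transpose_mat Sigma_minus = Sigma_minus"
  using Sigma_carrier by (auto intro!: eq_matI simp: Sigma_index add.commute insert_commute)

text \<open>Each coordinate lies on two edges, so the quadratic form is (1 - 2r) times the sum of
  squares plus r times the sum of the squares \<open>(v_i + v_j)^2\<close> over the edges, with a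
  minus sign inside for the negative edge. At r = 2/5 the factor 1 - 2r is 1/5.\<close>

lemma positive_definite_Sigma:
  shows "positive_definite 4 Sigma_plus" "positive_definite 4 Sigma_minus"
proof -
  have pos: "0 < scalar_prod v (A *\<^sub>v v)"
    if v: "v \<in> carrier_vec 4" "v \<noteq> 0\<^sub>v 4" and A: "A \<in> carrier_mat 4 4"
      and sos: "scalar_prod v (A *\<^sub>v v) = (1/5) * (\<Sum>i<4. (vec_index v i)\<^sup>2) + (2/5) * q" "0 \<le> q"
    for v :: "real vec" and A q
  proof -
    have "\<exists>i<4. vec_index v i \<noteq> 0"
      using v by (metis carrier_vecD eq_vecI index_zero_vec)
    then have "0 < (\<Sum>i<4. (vec_index v i)\<^sup>2)"
      by (auto intro!: sum_pos2)
    then show ?thesis using sos by simp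
  qed
  show "positive_definite 4 Sigma_plus"
    unfolding positive_definite_def
  proof (intro conjI ballI impI Sigma_carrier Sigma_symmetric)
    fix v :: "real vec" assume v: "v \<in> carrier_vec 4" "v \<noteq> 0\<^sub>v 4"
    let ?q = "(vec_index v 0 + vec_index v 1)\<^sup>2 + (vec_index v 1 + vec_index v 2)\<^sup>2 +
      (vec_index v 2 + vec_index v 3)\<^sup>2 + (vec_index v 3 + vec_index v 0)\<^sup>2"
    have "scalar_prod v (Sigma_plus *\<^sub>v v) = (1/5) * (\<Sum>i<4. (vec_index v i)\<^sup>2) + (2/5) * ?q"
      using v Sigma_carrier
      by (auto simp: scalar_prod_def atLeast0LessThan lessThan_4 Sigma_index power2_eq_square algebra_simps)
    then show "0 < scalar_prod v (Sigma_plus *\<^sub>v v)"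
      by (rule pos[OF v Sigma_carrier(1)]) simp
  qed
  show "positive_definite 4 Sigma_minus"
    unfolding positive_definite_def
  proof (intro conjI ballI impI Sigma_carrier Sigma_symmetric)
    fix v :: "real vec" assume v: "v \<in> carrier_vec 4" "v \<noteq> 0\<^sub>v 4"
    let ?q = "(vec_index v 0 + vec_index v 1)\<^sup>2 + (vec_index v 1 + vec_index v 2)\<^sup>2 +
      (vec_index v 2 + vec_index v 3)\<^sup>2 + (vec_index v 3 - vec_index v 0)\<^sup>2"
    have "scalar_prod v (Sigma_minus *\<^sub>v v) = (1/5) * (\<Sum>i<4. (vec_index v i)\<^sup>2) + (2/5) * ?q"
      using v Sigma_carrier
      by (auto simp: scalar_prod_def atLeast0LessThan lessThan_4 Sigma_index power2_eq_square algebra_simps doubleton_eq_iff)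
    then show "0 < scalar_prod v (Sigma_minus *\<^sub>v v)"
      by (rule pos[OF v Sigma_carrier(2)]) simp
  qed
qed

lemma mat_diag_conjugate:
  assumes "A \<in> carrier_mat k k"
  shows "mat_diag k e * A * mat_diag k e = Matrix.mat k k (\<lambda>(i, j). e i * A $$ (i, j) * e j)"
  using assms by (auto simp: mat_diag_mult_left mat_diag_mult_right[of _ k k] intro!: eq_matI)

lemma not_diag_sign_conjugate_Sigma: "\<not> diag_sign_conjugate 4 Sigma_plus Sigma_minus"
proof
  assume "diag_sign_conjugate 4 Sigma_plus Sigma_minus"
  then obtain e where eq: "Sigma_minus = Matrix.mat 4 4 (\<lambda>(i, j). e i * Sigma_plus $$ (i, j) * e j)"
    using Sigma_carrier by (auto simp: diag_sign_conjugate_def mat_diag_conjugate)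
  have "Sigma_minus $$ (i, j) = e i * Sigma_plus $$ (i, j) * e j" if "i < 4" "j < 4" for i j
    using that by (subst eq) simp
  note entry = this
  have e: "e 0 * e 1 = 1" "e 1 * e 2 = 1" "e 2 * e 3 = 1" "e 0 * e 3 = - 1"
    using entry[of 0 1] entry[of 1 2] entry[of 2 3] entry[of 0 3]
    by (simp_all add: Sigma_index doubleton_eq_iff)
  \<comment> \<open>Each sign occurs on two edges of the cycle, so the product of the four edge
    values is a real square, yet it would have to be -1.\<close>
  have "(e 0 * e 1 * e 2 * e 3)\<^sup>2 = (e 0 * e 1) * (e 1 * e 2) * (e 2 * e 3) * (e 0 * e 3)"
    by (simp add: power2_eq_square)
  also have "\<dots> = - 1"
    by (simp only: e)
  finally show False
    using zero_le_power2[of "e 0 * e 1 * e 2 * e 3"] by linarith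
qed

text \<open>The two matrices differ only by the sign of one edge of the 4-cycle of nonzero correlations,
  and removing a coordinate breaks the cycle: a sign flip of the endpoint 0 or 3 undoes the difference.\<close>
lemma Sigma_sign_gauge:
  assumes "S \<subseteq> {..<4}" "card S \<le> 3"
  obtains e :: "nat \<Rightarrow> real" where "\<And>i. e i \<in> {1, - 1}"
    "\<And>i j. i \<in> S \<Longrightarrow> j \<in> S \<Longrightarrow> Sigma_minus $$ (i, j) = e i * Sigma_plus $$ (i, j) * e j"
proof -
  have "S \<noteq> {..<4}" using assms by auto
  then obtain m where m: "m < 4" "m \<notin> S" using assms by blast
  let ?e = "\<lambda>i. if m = 1 \<and> i = 0 \<or> m = 2 \<and> i = 3 then - 1 else 1 :: real"
  show ?thesis
  proof (rule that[of ?e])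
    fix i j assume ij: "i \<in> S" "j \<in> S"
    then have less: "i < 4" "j < 4" and "i \<noteq> m" "j \<noteq> m" using assms m by auto
    moreover have "i \<in> {0, 1, 2, 3}" "j \<in> {0, 1, 2, 3}" "m \<in> {0, 1, 2, 3}"
      using less m by (auto simp flip: lessThan_4)
    ultimately show "Sigma_minus $$ (i, j) = ?e i * Sigma_plus $$ (i, j) * ?e j"
      by (auto simp: Sigma_index doubleton_eq_iff)
  qed auto
qed

lemma diag_sign_conjugate_submatrix_Sigma:
  assumes S: "S \<subseteq> {..<4}" "card S \<le> 3"
  shows "diag_sign_conjugate (card S) (principal_submatrix Sigma_plus S) (principal_submatrix Sigma_minus S)"
proof -
  obtain e :: "nat \<Rightarrow> real" where e: "\<And>i. e i \<in> {1, - 1}"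
    "\<And>i j. i \<in> S \<Longrightarrow> j \<in> S \<Longrightarrow> Sigma_minus $$ (i, j) = e i * Sigma_plus $$ (i, j) * e j"
    using Sigma_sign_gauge[OF S] by blast
  \<comment> \<open>The dimension of a submatrix counts the indices below 4 that lie in
    \<open>S\<close>; this identifies it with \<open>card S\<close>.\<close>
  have Collect_S: "{i. i < 4 \<and> i \<in> S} = S" using S by auto
  have pick: "pick S i \<in> S" "pick S i < 4" if "i < card S" for i
    using pick_in_set_le[OF that] S by auto
  have sub: "principal_submatrix A S = Matrix.mat (card S) (card S) (\<lambda>(i, j). A $$ (pick S i, pick S j))"
    if "A \<in> carrier_mat 4 4" for A :: "real mat"
    using that by (simp add: submatrix_def Collect_S)
  have sym: "A $$ (i, j) = A $$ (j, i)"
    if "A \<in> carrier_mat 4 4" "transpose_mat A = A" "i < 4" "j < 4" for A :: "real mat" and i j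
    using that by (metis carrier_matD index_transpose_mat(1))
  show ?thesis
    unfolding diag_sign_conjugate_def
  \<comment> \<open>Row \<open>i\<close> of the submatrix is row \<open>pick S i\<close> of the full
    matrix, so the signs are relabelled along \<open>pick S\<close>.\<close>
  proof (intro conjI exI[of _ "\<lambda>i. e (pick S i)"])
    show "principal_submatrix Sigma_minus S =
      mat_diag (card S) (\<lambda>i. e (pick S i)) * principal_submatrix Sigma_plus S * mat_diag (card S) (\<lambda>i. e (pick S i))"
      using e(2) pick by (auto simp: sub Sigma_carrier mat_diag_conjugate intro!: eq_matI)
    show "transpose_mat (principal_submatrix Sigma_plus S) = principal_submatrix Sigma_plus S"
      using sym[OF Sigma_carrier(1) Sigma_symmetric(1)] pick by (auto simp: sub Sigma_carrier intro!: eq_matI)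
    show "transpose_mat (principal_submatrix Sigma_minus S) = principal_submatrix Sigma_minus S"
      using sym[OF Sigma_carrier(2) Sigma_symmetric(2)] pick by (auto simp: sub Sigma_carrier intro!: eq_matI)
  qed (use e(1) in \<open>auto simp: sub Sigma_carrier\<close>)
qed

section \<open>Transfer of the gauge to moments\<close>

lemma abs_product_moment_Sigma_eq:
  assumes GX: "gaussian_vector M 4 X" "centered M 4 X" and UX: "unit_variances M 4 X"
    and RX: "correlation_matrix M 4 X = Sigma_plus"
    and GY: "gaussian_vector N 4 Y" "centered N 4 Y" and UY: "unit_variances N 4 Y"
    and RY: "correlation_matrix N 4 Y = Sigma_minus"
    and S: "S \<subseteq> {..<4}" "card S \<le> 3"
  shows "abs_product_moment M X S p = abs_product_moment N Y S p"
proof -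
  obtain e :: "nat \<Rightarrow> real" where e: "\<And>i. e i \<in> {1, - 1}"
    and gauge: "\<And>i j. i \<in> S \<Longrightarrow> j \<in> S \<Longrightarrow> Sigma_minus $$ (i, j) = e i * Sigma_plus $$ (i, j) * e j"
    using Sigma_sign_gauge[OF S] by blast
  have e_sq: "e i * (e i * x) = x" and e_abs: "\<bar>e i\<bar> = 1" for i x
    using e[of i] by auto
  have fin: "finite S" using S(1) by (rule finite_subset) simp
  have less: "i < 4" if "i \<in> S" for i using S that by auto
  \<comment> \<open>Flipping \<open>Y\<close> by the gauge of \<open>S\<close> gives it the second
    moments of \<open>X\<close> on \<open>S\<close>, each sign then occurring twice. The gauge has
    to depend on \<open>S\<close>, since none works for all four coordinates.\<close>
  let ?Y = "\<lambda>i \<omega>. e i * Y i \<omega>"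
  have GeY: "gaussian_vector N 4 ?Y" using GY(1) by (rule gaussian_vector_scale)
  have CeY: "centered N 4 ?Y" using GY(2) by (simp add: centered_def)
  have cov: "(\<integral>\<omega>. X i \<omega> * X j \<omega> \<partial>M) = (\<integral>\<omega>. ?Y i \<omega> * ?Y j \<omega> \<partial>N)" if "i \<in> S" "j \<in> S" for i j
  proof -
    have "(\<integral>\<omega>. ?Y i \<omega> * ?Y j \<omega> \<partial>N) = (\<integral>\<omega>. (e i * e j) * (Y i \<omega> * Y j \<omega>) \<partial>N)"
      by (simp add: ac_simps)
    also have "\<dots> = e i * e j * Sigma_minus $$ (i, j)"
      using correlation_matrix_index[OF GY(2) UY] less that by (simp add: RY)
    also have "\<dots> = e i * (e i * (e j * (e j * Sigma_plus $$ (i, j))))"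
      using gauge that by (simp add: ac_simps)
    also have "\<dots> = (\<integral>\<omega>. X i \<omega> * X j \<omega> \<partial>M)"
      using correlation_matrix_index[OF GX(2) UX] less that by (simp add: RX e_sq)
    finally show ?thesis ..
  qed
  have "abs_product_moment M X S p = abs_product_moment N ?Y S p"
    using gaussian_vectorD(2)[OF GX(1)] gaussian_vectorD(2)[OF GeY] less
    by (simp only: abs_product_moment_eq_nn_integral_law[OF fin] gaussian_vector_law_eqI[OF GX GeY CeY S(1) cov])
  also have "\<dots> = abs_product_moment N Y S p"
    by (simp add: abs_product_moment_def abs_mult e_abs)
  finally show ?thesis .
qed

theorem proposition10p2:
  shows "positive_definite 4 Sigma_plus \<and> positive_definite 4 Sigma_minus \<and>
    \<not> diag_sign_conjugate 4 Sigma_plus Sigma_minus \<and>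
    (\<forall>S \<subseteq> {..<4}. card S \<le> 3 \<longrightarrow>
       diag_sign_conjugate (card S)
         (principal_submatrix Sigma_plus S) (principal_submatrix Sigma_minus S)) \<and>
    (\<forall>(M :: 'a measure) (N :: 'b measure) X Y.
       gaussian_vector M 4 X \<and> centered M 4 X \<and> unit_variances M 4 X \<and>
       correlation_matrix M 4 X = Sigma_plus \<and>
       gaussian_vector N 4 Y \<and> centered N 4 Y \<and> unit_variances N 4 Y \<and>
       correlation_matrix N 4 Y = Sigma_minus \<longrightarrow>
       (\<forall>S \<subseteq> {..<4}. card S \<le> 3 \<longrightarrow> (\<forall>p :: nat \<Rightarrow> real.
          abs_product_moment M X S p = abs_product_moment N Y S p \<and>
          ((\<forall>i\<in>S. 0 \<le> p i) \<longrightarrow> abs_product_moment M X S p < \<infinity>))))"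
proof (intro conjI allI impI)
  fix M :: "'a measure" and N :: "'b measure" and X Y and S :: "nat set" and p :: "nat \<Rightarrow> real"
  assume *: "gaussian_vector M 4 X \<and> centered M 4 X \<and> unit_variances M 4 X \<and>
      correlation_matrix M 4 X = Sigma_plus \<and>
      gaussian_vector N 4 Y \<and> centered N 4 Y \<and> unit_variances N 4 Y \<and>
      correlation_matrix N 4 Y = Sigma_minus"
    and S: "S \<subseteq> {..<4}" "card S \<le> 3"
  show "abs_product_moment M X S p = abs_product_moment N Y S p"
    using * S by (intro abs_product_moment_Sigma_eq) auto
  \<comment> \<open>Finiteness of the moment of \<open>Y\<close> follows through the equality
    above.\<close>
  show "abs_product_moment M X S p < \<infinity>" if "\<forall>i\<in>S. 0 \<le> p i"
    using * S(1) that gaussian_vector_abs_product_moment_finite by blast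
qed (simp_all add: positive_definite_Sigma not_diag_sign_conjugate_Sigma diag_sign_conjugate_submatrix_Sigma)

end
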